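(* Let $\mathbb{F}_q$ be a finite field of characteristic different from $2$ and let $n,k,r$ be positive integers. The set of simultaneously diagonalizable via congruence (SDC) $k$-tuples of homogeneous forms of degree $r$ in $n$ variables over $\mathbb{F}_q$ is a subset of the neuromanifold $\mathcal{P}_{(n,n,k),r}(\mathbb{F}_q)$. Therefore, the number of SDC $k$-tuples is a lower bound for $|\mathcal{P}_{(n,n,k),r}(\mathbb{F}_q)|$.
   Context: A $k$-tuple $(f_1,\dots,f_k)$ of homogeneous polynomials of degree $r$ in $\mathbb{F}_q[x_1,\dots,x_n]$ is called simultaneously diagonalizable via congruence (SDC) if there exist $n$ linearly independent linear forms $L_1,\dots,L_n$ in $x_1,\dots,x_n$ over $\mathbb{F}_q$ and coefficients $c_{ij}\in\mathbb{F}_q$ such that $f_i=c_{i1}L_1^r+\dots+c_{in}L_n^r$ for all $i=1,\dots,k$. The neuromanifold $\mathcal{P}_{(n,n,k),r}(\mathbb{F}_q)$ is the set of all $k$-tuples $(f_1,\dots,f_k)$ of homogeneous polynomials of degree $r$ in $\mathbb{F}_q[x_1,\dots,x_n]$ of the form $f_i=\sum_{s=1}^n b_{is}(a_{s1}x_1+\dots+a_{sn}x_n)^r$, $i=1,\dots,k$, with $(a_{sj})\in\mathbb{F}_q^{n\times n}$ and $(b_{is})\in\mathbb{F}_q^{k\times n}$ arbitrary. *)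

theory Defs
  imports "HOL-Library.Poly_Mapping" "HOL-Library.FuncSet"
begin

text \<open>
  Polynomials are formal (over a finite field they differ from polynomial functions): a monomial
  is a finitely supported exponent vector, a polynomial a finitely supported coefficient family,
  and multiplication is the convolution product of \<^typ>\<open>'a \<Rightarrow>\<^sub>0 'b\<close>. The variables
  $x_1,\dots,x_n$ are those with indices in \<open>{1..n}\<close>.
\<close>

type_synonym 'a mpoly = "(nat \<Rightarrow>\<^sub>0 nat) \<Rightarrow>\<^sub>0 'a"

definition Const :: "'a::zero \<Rightarrow> 'a mpoly" where
  "Const c = Poly_Mapping.single 0 c"

definition Var :: "nat \<Rightarrow> 'a::zero_neq_one mpoly" where
  "Var j = Poly_Mapping.single (Poly_Mapping.single j 1) 1"

text \<open>As usual, the zero polynomial counts as homogeneous of every degree.\<close>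

definition forms :: "nat \<Rightarrow> nat \<Rightarrow> 'a::zero mpoly set" where
  "forms n r = {p. \<forall>m \<in> Poly_Mapping.keys p.
     Poly_Mapping.keys m \<subseteq> {1..n} \<and> (\<Sum>j\<in>{1..n}. Poly_Mapping.lookup m j) = r}"

definition lin_indep :: "nat \<Rightarrow> (nat \<Rightarrow> 'a::field mpoly) \<Rightarrow> bool" where
  "lin_indep n L \<longleftrightarrow>
     (\<forall>c :: nat \<Rightarrow> 'a. (\<Sum>s\<in>{1..n}. Const (c s) * L s) = 0 \<longrightarrow> (\<forall>s\<in>{1..n}. c s = 0))"

text \<open>
  A \<open>k\<close>-tuple is a function on \<open>{1..k}\<close>, made extensional so that tuples are counted correctly.
\<close>

definition SDC :: "nat \<Rightarrow> nat \<Rightarrow> nat \<Rightarrow> (nat \<Rightarrow> 'a::field mpoly) set" where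
  "SDC n k r = {f \<in> {1..k} \<rightarrow>\<^sub>E forms n r.
     \<exists>(L :: nat \<Rightarrow> 'a mpoly) (c :: nat \<Rightarrow> nat \<Rightarrow> 'a).
       (\<forall>s\<in>{1..n}. L s \<in> forms n 1) \<and> lin_indep n L \<and>
       (\<forall>i\<in>{1..k}. f i = (\<Sum>s\<in>{1..n}. Const (c i s) * L s ^ r))}"

definition neuromanifold :: "nat \<Rightarrow> nat \<Rightarrow> nat \<Rightarrow> (nat \<Rightarrow> 'a::field mpoly) set" where
  "neuromanifold n k r = {f \<in> {1..k} \<rightarrow>\<^sub>E forms n r.
     \<exists>(a :: nat \<Rightarrow> nat \<Rightarrow> 'a) (b :: nat \<Rightarrow> nat \<Rightarrow> 'a).
       \<forall>i\<in>{1..k}. f i =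
         (\<Sum>s\<in>{1..n}. Const (b i s) * (\<Sum>j\<in>{1..n}. Const (a s j) * Var j) ^ r)}"

text \<open>By finiteness, \<^const>\<open>card\<close> is the true cardinality of the neuromanifold and of its subsets.\<close>

lemma finite_neuromanifold:
  "finite (neuromanifold n k r :: (nat \<Rightarrow> 'a::{field,finite} mpoly) set)"
proof -
  define F :: "(nat \<times> nat \<Rightarrow> 'a) \<times> (nat \<times> nat \<Rightarrow> 'a) \<Rightarrow> nat \<Rightarrow> 'a mpoly" where
    "F = (\<lambda>(a, b). \<lambda>i\<in>{1..k}.
       \<Sum>s\<in>{1..n}. Const (b (i, s)) * (\<Sum>j\<in>{1..n}. Const (a (s, j)) * Var j) ^ r)"
  define M :: "((nat \<times> nat \<Rightarrow> 'a) \<times> (nat \<times> nat \<Rightarrow> 'a)) set" where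
    "M = ({1..n} \<times> {1..n} \<rightarrow>\<^sub>E UNIV) \<times> ({1..k} \<times> {1..n} \<rightarrow>\<^sub>E UNIV)"
  have "neuromanifold n k r \<subseteq> F ` M"
  proof
    fix f :: "nat \<Rightarrow> 'a mpoly" assume "f \<in> neuromanifold n k r"
    then obtain a b where f: "f \<in> {1..k} \<rightarrow>\<^sub>E forms n r"
      and ab: "\<And>i. i \<in> {1..k} \<Longrightarrow> f i =
         (\<Sum>s\<in>{1..n}. Const (b i s) * (\<Sum>j\<in>{1..n}. Const (a s j) * Var j) ^ r)"
      unfolding neuromanifold_def by blast
    define x where "x = (restrict (\<lambda>(s, j). a s j) ({1..n} \<times> {1..n}),
                         restrict (\<lambda>(i, s). b i s) ({1..k} \<times> {1..n}))"
    have "f = F x"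
    proof
      fix i show "f i = F x i"
      proof (cases "i \<in> {1..k}")
        case True
        then show ?thesis
          unfolding ab[OF True] F_def x_def by (auto intro!: sum.cong)
      next
        case False
        then have "f i = undefined" using f by (rule PiE_arb[rotated])
        then show ?thesis using False by (simp add: F_def x_def restrict_def del: atLeastAtMost_iff)
      qed
    qed
    moreover have "x \<in> M" by (auto simp: x_def M_def)
    ultimately show "f \<in> F ` M" by blast
  qed
  moreover have "finite M" unfolding M_def by (intro finite_cartesian_product finite_PiE) auto
  ultimately show ?thesis by (blast intro: finite_subset)
qed

end

theory Submission
  imports Defs
begin

text \<open>An SDC representation of a tuple is already a neuromanifold representation once each
  linear form \<open>L s\<close> is written out in the variables: its coefficients form row
  \<open>s\<close> of the matrix \<open>a\<close>, and the \<open>c i s\<close> serve as the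
  \<open>b i s\<close>. The work lies in passing from the support condition \<open>forms n 1\<close>
  to an explicit combination of variables, done in \<open>linear_form_expansion\<close>. The bound
  on cardinalities is monotonicity of \<open>card\<close> inside the finite set given by
  \<open>finite_neuromanifold\<close>.\<close>

lemma degree_one_monomial:
  fixes m :: "nat \<Rightarrow>\<^sub>0 nat"
  assumes keys: "Poly_Mapping.keys m \<subseteq> {1..n}"
    and deg: "(\<Sum>j\<in>{1..n}. Poly_Mapping.lookup m j) = 1"
  shows "\<exists>j\<in>{1..n}. m = Poly_Mapping.single j 1"
proof -
  obtain j where j: "j \<in> {1..n}" "Poly_Mapping.lookup m j = 1"
    and others: "\<And>i. i \<in> {1..n} \<Longrightarrow> i \<noteq> j \<Longrightarrow> Poly_Mapping.lookup m i = 0"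
    using deg sum_eq_1_iff[of "{1..n}" "Poly_Mapping.lookup m"] by auto
  have "m = Poly_Mapping.single j 1"
  proof (rule poly_mapping_eqI)
    fix i
    \<comment> \<open>The degree sum sees only indices in \<open>{1..n}\<close>; elsewhere the
      exponent vanishes by the support condition.\<close>
    have "Poly_Mapping.lookup m i = 0" if "i \<notin> {1..n}"
      using that keys by (meson in_keys_iff subsetD)
    then show "Poly_Mapping.lookup m i = Poly_Mapping.lookup (Poly_Mapping.single j 1) i"
      using j others[of i] by (cases "i = j") (auto simp: lookup_single when_def)
  qed
  then show ?thesis using j(1) by blast
qed

text \<open>Coefficients are compared monomial by monomial; by \<open>degree_one_monomial\<close>,
  every monomial in the support of \<open>p\<close> is one of the variables.\<close>

lemma linear_form_expansion:
  fixes p :: "'a::field mpoly"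
  assumes p: "p \<in> forms n 1"
  shows "p = (\<Sum>j\<in>{1..n}. Const (Poly_Mapping.lookup p (Poly_Mapping.single j 1)) * Var j)"
proof (rule poly_mapping_eqI)
  fix m
  let ?x = "\<lambda>j. Poly_Mapping.single j 1 :: nat \<Rightarrow>\<^sub>0 nat"
  \<comment> \<open>A summand contributes at \<open>m\<close> only if \<open>?x j = m\<close>, so
    its coefficient may be read off at \<open>m\<close> instead of \<open>?x j\<close>.\<close>
  have rhs: "Poly_Mapping.lookup (\<Sum>j\<in>{1..n}. Const (Poly_Mapping.lookup p (?x j)) * Var j) m
      = (\<Sum>j\<in>{1..n}. if ?x j = m then Poly_Mapping.lookup p m else 0)"
    by (auto simp: lookup_sum Const_def Var_def mult_single lookup_single when_def intro!: sum.cong)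
  show "Poly_Mapping.lookup p m =
      Poly_Mapping.lookup (\<Sum>j\<in>{1..n}. Const (Poly_Mapping.lookup p (?x j)) * Var j) m"
  proof (cases "m \<in> Poly_Mapping.keys p")
    case True
    then obtain i where i: "i \<in> {1..n}" "m = ?x i"
      using p degree_one_monomial[of m n] unfolding forms_def by blast
    \<comment> \<open>Distinct indices give distinct variables, so exactly one summand
      survives.\<close>
    have "?x j = m \<longleftrightarrow> j = i" for j
      using i(2) by (metis lookup_single_eq lookup_single_not_eq one_neq_zero)
    then show ?thesis unfolding rhs using i(1) by simp
  next
    case False
    \<comment> \<open>Here \<open>p\<close> has coefficient 0 at \<open>m\<close>, so every summand
      vanishes whichever branch applies.\<close>
    then show ?thesis unfolding rhs by (simp add: in_keys_iff cong: if_cong)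
  qed
qed

lemma SDC_subset_neuromanifold:
  "(SDC n k r :: (nat \<Rightarrow> 'a::field mpoly) set) \<subseteq> neuromanifold n k r"
proof
  fix f :: "nat \<Rightarrow> 'a mpoly" assume "f \<in> SDC n k r"
  then obtain L c where f: "f \<in> {1..k} \<rightarrow>\<^sub>E forms n r"
    and L: "\<forall>s\<in>{1..n}. L s \<in> forms n 1"
    and fi: "\<forall>i\<in>{1..k}. f i = (\<Sum>s\<in>{1..n}. Const (c i s) * L s ^ r)"
    unfolding SDC_def by blast
  define a where "a s j = Poly_Mapping.lookup (L s) (Poly_Mapping.single j 1)" for s j
  have La: "L s = (\<Sum>j\<in>{1..n}. Const (a s j) * Var j)" if "s \<in> {1..n}" for s
    unfolding a_def by (rule linear_form_expansion) (use L that in blast)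
  have "\<forall>i\<in>{1..k}. f i =
      (\<Sum>s\<in>{1..n}. Const (c i s) * (\<Sum>j\<in>{1..n}. Const (a s j) * Var j) ^ r)"
    using fi La by simp
  then show "f \<in> neuromanifold n k r"
    unfolding neuromanifold_def using f by blast
qed

theorem lemma3p9:
  fixes n k r :: nat
  assumes "CHAR('a::{field,finite}) \<noteq> 2"
    and "n > 0" and "k > 0" and "r > 0"
  shows "(SDC n k r :: (nat \<Rightarrow> 'a mpoly) set) \<subseteq> neuromanifold n k r \<and>
    card (SDC n k r :: (nat \<Rightarrow> 'a mpoly) set) \<le> card (neuromanifold n k r :: (nat \<Rightarrow> 'a mpoly) set)"
  \<comment> \<open>Finiteness of the larger set matters, since \<open>card\<close> is 0 on infinite
    sets.\<close>
  by (intro conjI card_mono finite_neuromanifold SDC_subset_neuromanifold)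

end
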